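(* Every $r$-dependent point process on $\mathbb{R}^d$ satisfies the EDD.
   Context: A point process $\Xi$ on $\mathbb{R}^d$ is $r$-dependent ($r>0$) if for any Borel sets $A,B\subset\mathbb{R}^d$ with $d(A,B)\ge r$ the restrictions $\Xi_A$ and $\Xi_B$ of $\Xi$ to $A$ and $B$ are independent. EDD. For $A_1,A_2\in\mathscr B(\mathbb{R}^d)$ the $\beta$-mixing coefficient is $\beta_{A_1,A_2}=\frac12\int\int|\mathbb{P}(\Xi_{A_1}\in d\zeta_1,\Xi_{A_2}\in d\zeta_2)-\mathbb{P}(\Xi_{A_1}\in d\zeta_1)\mathbb{P}(\Xi_{A_2}\in d\zeta_2)|$ (integration over configurations on $A_1$ and $A_2$). $\mathrm{diam}(A)=\sup\{\|x-y\|:x,y\in A\}$, $d(A,B)=\inf\{\|x-y\|:x\in A,y\in B\}$, $\sup\emptyset=0$, $\inf\emptyset=\infty$. $\Xi$ has exponentially decay dependence (EDD) if there are constants $\theta_0\ge0$, $\theta_1,\dots,\theta_4>0$ such that $\beta_{A,B}\le\theta_1(\mathrm{diam}(A)^{\theta_0}\vee1)(\mathrm{diam}(B)^{\theta_0}\vee1)e^{-\theta_2d(A,B)}$ for all Borel $A,B$ with $d(A,B)\ge\theta_3\ln(\mathrm{diam}(A)\vee\mathrm{diam}(B)\vee\theta_4)$. *)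

theory Defs
  imports "HOL-Probability.Probability"
begin

section \<open>Point processes\<close>

text \<open>Configurations on a Borel set \<open>A\<close> of \<open>R^d\<close>: locally finite counting measures on the Borel subsets
  of \<open>A\<close>; points may have multiplicities. Local finiteness means finite mass on the bounded Borel
  subsets of \<open>A\<close>, with boundedness taken in \<open>R^d\<close>.\<close>

definition configurations :: "'a::euclidean_space set \<Rightarrow> 'a measure set" where
  "configurations A = {\<zeta>. sets \<zeta> = sets (restrict_space borel A) \<and>
     (\<forall>B\<in>sets (restrict_space borel A). bounded B \<longrightarrow> emeasure \<zeta> B \<in> \<nat>)}"

text \<open>The configurations on \<open>A\<close>, with the \<open>\<sigma>\<close>-algebra generated by the counts \<open>\<zeta> \<mapsto> \<zeta>(B)\<close> of the Borel
  subsets \<open>B\<close> of \<open>A\<close> (constructed in the same way as \<^const>\<open>subprob_algebra\<close>). Only the space and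
  the \<open>\<sigma>\<close>-algebra of this measure are meaningful.\<close>

definition config_space :: "'a::euclidean_space set \<Rightarrow> 'a measure measure" where
  "config_space A = (SUP B \<in> sets (restrict_space borel A).
     vimage_algebra (configurations A) (\<lambda>\<zeta>. emeasure \<zeta> B) borel)"

definition point_process :: "'w measure \<Rightarrow> ('w \<Rightarrow> 'a::euclidean_space measure) \<Rightarrow> bool" where
  "point_process M \<Xi> \<longleftrightarrow> prob_space M \<and> \<Xi> \<in> measurable M (config_space UNIV)"

definition restriction :: "('w \<Rightarrow> 'a::euclidean_space measure) \<Rightarrow> 'a set \<Rightarrow> 'w \<Rightarrow> 'a measure" where
  "restriction \<Xi> A = (\<lambda>\<omega>. restrict_space (\<Xi> \<omega>) A)"

lemma space_config_space: "space (config_space A) = configurations A"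
  by (auto simp: config_space_def space_Sup_eq_UN)

lemma measurable_emeasure_config_space [measurable]:
  "B \<in> sets (restrict_space borel A) \<Longrightarrow> (\<lambda>\<zeta>. emeasure \<zeta> B) \<in> borel_measurable (config_space A)"
  by (auto intro!: measurable_Sup1 measurable_vimage_algebra1 simp: config_space_def)

lemma restrict_space_configurations:
  assumes "A \<in> sets borel" "\<zeta> \<in> configurations (UNIV :: 'a::euclidean_space set)"
  shows "restrict_space \<zeta> A \<in> configurations A"
proof -
  have s: "sets \<zeta> = sets borel" and n: "\<And>B. B \<in> sets borel \<Longrightarrow> bounded B \<Longrightarrow> emeasure \<zeta> B \<in> \<nat>"
    using assms(2) by (auto simp: configurations_def)
  have sp: "space \<zeta> = UNIV" using sets_eq_imp_space_eq[OF s] by simp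
  show ?thesis
    unfolding configurations_def
    using assms(1) s n sp
    by (auto simp: sets_restrict_space_iff emeasure_restrict_space cong: sets_restrict_space_cong)
qed

lemma measurable_restrict_config_space:
  fixes A :: "'a::euclidean_space set"
  assumes "A \<in> sets borel"
  shows "(\<lambda>\<zeta>. restrict_space \<zeta> A) \<in> measurable (config_space UNIV) (config_space A)"
  unfolding config_space_def[of A]
proof (rule measurable_SUP2)
  show "sets (restrict_space borel A) \<noteq> {}" by (metis empty_iff sets.empty_sets)
next
  fix B assume B: "B \<in> sets (restrict_space borel A)"
  then have B': "B \<in> sets borel" "B \<subseteq> A" using assms by (auto simp: sets_restrict_space_iff)
  show "(\<lambda>\<zeta>. restrict_space \<zeta> A) \<in> measurable (config_space UNIV)
      (vimage_algebra (configurations A) (\<lambda>\<zeta>. emeasure \<zeta> B) borel)"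
  proof (rule measurable_vimage_algebra2)
    show "(\<lambda>\<zeta>. restrict_space \<zeta> A) \<in> space (config_space UNIV) \<rightarrow> configurations A"
      using restrict_space_configurations[OF assms] by (auto simp: space_config_space)
    have "emeasure (restrict_space \<zeta> A) B = emeasure \<zeta> B" if "\<zeta> \<in> space (config_space UNIV)" for \<zeta>
    proof -
      have s: "sets \<zeta> = sets borel" using that by (simp add: space_config_space configurations_def)
      then show ?thesis using assms B' sets_eq_imp_space_eq[OF s] by (simp add: emeasure_restrict_space)
    qed
    then show "(\<lambda>\<zeta>. emeasure (restrict_space \<zeta> A) B) \<in> borel_measurable (config_space UNIV)"
      by (subst measurable_cong) (use B' in auto)
  qed
qed simp

lemma measurable_restriction:
  assumes "point_process M \<Xi>" "A \<in> sets borel"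
  shows "restriction \<Xi> A \<in> measurable M (config_space A)"
  unfolding restriction_def
  by (rule measurable_compose[OF _ measurable_restrict_config_space])
    (use assms in \<open>auto simp: point_process_def\<close>)


section \<open>Diameter and distance\<close>

text \<open>In \<^typ>\<open>ennreal\<close> the supremum of the empty set is \<open>0\<close> and the infimum of the empty set is \<open>\<infinity>\<close>,
  as required. The library versions are real-valued: \<^const>\<open>diameter\<close> is never \<open>\<infinity>\<close> on
  unbounded sets, and \<^const>\<open>setdist\<close> is \<open>0\<close> if one of the sets is empty.\<close>

definition diam :: "'a::euclidean_space set \<Rightarrow> ennreal" where
  "diam A = (SUP (x, y)\<in>A \<times> A. ennreal (norm (x - y)))"

definition set_distance :: "'a::euclidean_space set \<Rightarrow> 'a set \<Rightarrow> ennreal" where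
  "set_distance A B = (INF (x, y)\<in>A \<times> B. ennreal (norm (x - y)))"


section \<open>Dependence\<close>

definition r_dependent ::
  "real \<Rightarrow> 'w measure \<Rightarrow> ('w \<Rightarrow> 'a::euclidean_space measure) \<Rightarrow> bool" where
  "r_dependent r M \<Xi> \<longleftrightarrow> r > 0 \<and>
     (\<forall>A\<in>sets borel. \<forall>B\<in>sets borel. set_distance A B \<ge> ennreal r \<longrightarrow>
        prob_space.indep_var M (config_space A) (restriction \<Xi> A) (config_space B) (restriction \<Xi> B))"

text \<open>The total variation \<open>\<integral>|P - Q|\<close> of the signed measure \<open>P - Q\<close>, for finite measures \<open>P\<close>, \<open>Q\<close> on the
  same \<open>\<sigma>\<close>-algebra. It has no factor \<open>1/2\<close>.\<close>

definition total_variation :: "'b measure \<Rightarrow> 'b measure \<Rightarrow> ennreal" where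
  "total_variation P Q =
     (SUP \<E> \<in> {\<E>. finite \<E> \<and> \<E> \<subseteq> sets P \<and> partition_on (space P) \<E>}.
        \<Sum>E\<in>\<E>. ennreal \<bar>measure P E - measure Q E\<bar>)"

definition beta_mixing ::
  "'w measure \<Rightarrow> ('w \<Rightarrow> 'a::euclidean_space measure) \<Rightarrow> 'a set \<Rightarrow> 'a set \<Rightarrow> ennreal" where
  "beta_mixing M \<Xi> A B = ennreal (1/2) * total_variation
     (distr M (config_space A \<Otimes>\<^sub>M config_space B) (\<lambda>\<omega>. (restriction \<Xi> A \<omega>, restriction \<Xi> B \<omega>)))
     (distr M (config_space A) (restriction \<Xi> A) \<Otimes>\<^sub>M distr M (config_space B) (restriction \<Xi> B))"

text \<open>Extensions of the real functions to the values \<open>0\<close> and \<open>\<infinity>\<close> that \<^const>\<open>diam\<close> and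
  \<^const>\<open>set_distance\<close> may take. The exponent of \<open>ennreal_powr\<close> is meant to be nonnegative,
  and \<open>0^0 = \<infinity>^0 = 1\<close>.\<close>

definition ennreal_powr :: "ennreal \<Rightarrow> real \<Rightarrow> ennreal" where
  "ennreal_powr x a =
     (if a = 0 then 1 else if x = \<infinity> then \<infinity> else ennreal (enn2real x powr a))"

definition ennreal_ln :: "ennreal \<Rightarrow> ereal" where
  "ennreal_ln x =
     (if x = 0 then -\<infinity> else if x = \<infinity> then \<infinity> else ereal (ln (enn2real x)))"

definition ennreal_exp_minus :: "ennreal \<Rightarrow> ennreal" where
  "ennreal_exp_minus x = (if x = \<infinity> then 0 else ennreal (exp (- enn2real x)))"

definition EDD :: "'w measure \<Rightarrow> ('w \<Rightarrow> 'a::euclidean_space measure) \<Rightarrow> bool" where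
  "EDD M \<Xi> \<longleftrightarrow>
     (\<exists>\<theta>0 \<theta>1 \<theta>2 \<theta>3 \<theta>4 :: real. \<theta>0 \<ge> 0 \<and> \<theta>1 > 0 \<and> \<theta>2 > 0 \<and> \<theta>3 > 0 \<and> \<theta>4 > 0 \<and>
       (\<forall>A\<in>sets borel. \<forall>B\<in>sets borel.
          enn2ereal (set_distance A B)
            \<ge> ereal \<theta>3 * ennreal_ln (max (max (diam A) (diam B)) (ennreal \<theta>4)) \<longrightarrow>
          beta_mixing M \<Xi> A B
            \<le> ennreal \<theta>1 * max (ennreal_powr (diam A) \<theta>0) 1 * max (ennreal_powr (diam B) \<theta>0) 1
                * ennreal_exp_minus (ennreal \<theta>2 * set_distance A B)))"

end

theory Submission
  imports Defs
begin

text \<open>At distance at least \<open>r\<close> the two restrictions are independent, so their joint law is the product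
  of the marginal laws and the \<open>\<beta>\<close>-mixing coefficient vanishes (\<open>beta_mixing_eq_0_if_r_dependent\<close>).
  Hence the exponential bound holds with any constants for such sets, and what remains is to
  choose constants that make the distance condition of the EDD exclude all smaller distances.
  With \<open>\<theta>4 = e\<close> the logarithm in that condition is at least \<open>1\<close>, so \<open>\<theta>3 = r\<close> does this,
  also for sets that are empty or unbounded.\<close>

lemma total_variation_self [simp]: "total_variation P P = 0"
  unfolding total_variation_def by (auto simp: bot_ennreal intro!: antisym SUP_least)

lemma beta_mixing_eq_0_if_indep:
  assumes "point_process M \<Xi>" "A \<in> sets borel" "B \<in> sets borel"
    and indep: "prob_space.indep_var M (config_space A) (restriction \<Xi> A)
                  (config_space B) (restriction \<Xi> B)"
  shows "beta_mixing M \<Xi> A B = 0"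
proof -
  have "prob_space M"
    using assms(1) by (simp add: point_process_def)
  then have "distr M (config_space A) (restriction \<Xi> A) \<Otimes>\<^sub>M distr M (config_space B) (restriction \<Xi> B)
      = distr M (config_space A \<Otimes>\<^sub>M config_space B) (\<lambda>\<omega>. (restriction \<Xi> A \<omega>, restriction \<Xi> B \<omega>))"
    using indep by (simp add: prob_space.indep_var_distribution_eq)
  then show ?thesis
    by (simp add: beta_mixing_def)
qed

lemma beta_mixing_eq_0_if_r_dependent:
  assumes "point_process M \<Xi>" "r_dependent r M \<Xi>" "A \<in> sets borel" "B \<in> sets borel"
    and "set_distance A B \<ge> ennreal r"
  shows "beta_mixing M \<Xi> A B = 0"
  using assms by (auto simp: r_dependent_def intro!: beta_mixing_eq_0_if_indep)

lemma ennreal_ln_ge_1: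
  assumes "x \<ge> ennreal (exp 1)"
  shows "ennreal_ln x \<ge> 1"
proof (cases x)
  case (real y)
  then have "exp 1 \<le> y"
    using assms by (simp add: ennreal_le_iff)
  moreover from this have "0 < y"
    by (rule less_le_trans[OF exp_gt_zero])
  ultimately show ?thesis
    using real by (simp add: ennreal_ln_def ln_ge_iff)
next
  case top
  then show ?thesis
    by (simp add: ennreal_ln_def)
qed

theorem lemma3p3:
  fixes M :: "'w measure" and \<Xi> :: "'w \<Rightarrow> (real ^ 'd) measure" and r :: real
  assumes "point_process M \<Xi>"
    and "r_dependent r M \<Xi>"
  shows "EDD M \<Xi>"
proof -
  have r: "r > 0"
    using assms(2) by (simp add: r_dependent_def)
  have zero: "beta_mixing M \<Xi> A B = 0"
    if "A \<in> sets borel" "B \<in> sets borel"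
      and far: "ereal r * ennreal_ln (max (max (diam A) (diam B)) (ennreal (exp 1)))
                  \<le> enn2ereal (set_distance A B)"
    for A B :: "(real ^ 'd) set"
  proof -
    have "ereal r * 1 \<le> ereal r * ennreal_ln (max (max (diam A) (diam B)) (ennreal (exp 1)))"
      using r by (intro ereal_mult_left_mono ennreal_ln_ge_1) auto
    also note far
    finally have "ennreal r \<le> set_distance A B"
      using r by (simp add: less_eq_ennreal.rep_eq enn2ereal_ennreal)
    then show ?thesis
      using assms that(1,2) by (intro beta_mixing_eq_0_if_r_dependent)
  qed
  show ?thesis
    unfolding EDD_def
    by (rule exI[of _ 0], rule exI[of _ 1], rule exI[of _ 1], rule exI[of _ r],
        rule exI[of _ "exp 1"])
      (use r zero in auto)
qed

end
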